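(* Let $q\geq 3$ be an integer, let $G\in\mathcal{A}(q)$ with maximum degree $t\geq q+2$, and let $f$ and $g$ be two different proper $t$-colorings of $G$ such that the subgraph $G(f,g,t)$ has a component which is a path of odd length. Then there are two proper $t$-colorings $\overline f$ and $\overline g$ of $G$ such that $\overline f$ is $(q+1)$-equivalent to $f$, $\overline g$ is $(q+1)$-equivalent to $g$, and $|M(\overline f,t)\cap M(\overline g,t)|>|M(f,t)\cap M(g,t)|$.
   Context: Graphs are finite and simple. A $t$-coloring of $G$ is a map $f:E(G)\to\{1,\dots,t\}$; it is proper if adjacent edges get distinct colors. $M(f,j)$ is the set of edges of color $j$ under $f$. For an integer $q\geq 2$, $\mathcal{A}(q)$ is the set of graphs $G$ such that every subgraph $H$ of $G$ with $\Delta(H)\leq q$ has a proper $q$-edge-coloring. $G(f,g,t)$ is the subgraph of $G$ formed by the edge set $M(f,t)\triangle M(g,t)$ (symmetric difference) together with its endpoints. Two $t$-colorings differ by at most $n$ color classes if the number of colors $j$ with $M(f,j)\neq M(g,j)$ is at most $n$. Two proper $t$-colorings $f,h$ are $n$-equivalent if there is a sequence $f_0=f,f_1,\dots,f_k=h$ ($k\geq 1$) of proper $t$-colorings of $G$ with $f_i$ differing from $f_{i-1}$ by at most $n$ color classes for each $i$. *)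

theory Defs
  imports Main "HOL-Library.FuncSet"
begin

record 'a sgraph =
  verts :: "'a set"
  edges :: "'a set set"

definition simple_graph :: "'a sgraph \<Rightarrow> bool" where
  "simple_graph G \<longleftrightarrow> finite (verts G) \<and> (\<forall>e\<in>edges G. e \<subseteq> verts G \<and> card e = 2)"

definition subgraph :: "'a sgraph \<Rightarrow> 'a sgraph \<Rightarrow> bool" where
  "subgraph H G \<longleftrightarrow> simple_graph H \<and> verts H \<subseteq> verts G \<and> edges H \<subseteq> edges G"

definition vdegree :: "'a sgraph \<Rightarrow> 'a \<Rightarrow> nat" where
  "vdegree G v = card {e \<in> edges G. v \<in> e}"

text \<open>The inserted 0 only matters for the graph without vertices, whose maximum degree is 0.\<close>

definition max_degree :: "'a sgraph \<Rightarrow> nat" where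
  "max_degree G = Max (insert 0 (vdegree G ` verts G))"

text \<open>Colorings are extensional functions, so that equality of colorings is equality of maps
  on the edge set.\<close>

definition edge_coloring :: "'a sgraph \<Rightarrow> nat \<Rightarrow> ('a set \<Rightarrow> nat) \<Rightarrow> bool" where
  "edge_coloring G t f \<longleftrightarrow> f \<in> edges G \<rightarrow>\<^sub>E {1..t}"

definition adjacent_edges :: "'a set \<Rightarrow> 'a set \<Rightarrow> bool" where
  "adjacent_edges e e' \<longleftrightarrow> e \<noteq> e' \<and> e \<inter> e' \<noteq> {}"

definition proper_edge_coloring :: "'a sgraph \<Rightarrow> nat \<Rightarrow> ('a set \<Rightarrow> nat) \<Rightarrow> bool" where
  "proper_edge_coloring G t f \<longleftrightarrow> edge_coloring G t f \<and>
     (\<forall>e\<in>edges G. \<forall>e'\<in>edges G. adjacent_edges e e' \<longrightarrow> f e \<noteq> f e')"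

definition color_class :: "'a sgraph \<Rightarrow> ('a set \<Rightarrow> nat) \<Rightarrow> nat \<Rightarrow> 'a set set" where
  "color_class G f j = {e \<in> edges G. f e = j}"

definition class_A :: "nat \<Rightarrow> 'a sgraph set" where
  "class_A q = {G. simple_graph G \<and>
     (\<forall>H. subgraph H G \<and> max_degree H \<le> q \<longrightarrow> (\<exists>f. proper_edge_coloring H q f))}"

definition color_diff_edges ::
  "'a sgraph \<Rightarrow> ('a set \<Rightarrow> nat) \<Rightarrow> ('a set \<Rightarrow> nat) \<Rightarrow> nat \<Rightarrow> 'a set set" where
  "color_diff_edges G f g j =
     (color_class G f j - color_class G g j) \<union> (color_class G g j - color_class G f j)"

definition color_diff_graph ::
  "'a sgraph \<Rightarrow> ('a set \<Rightarrow> nat) \<Rightarrow> ('a set \<Rightarrow> nat) \<Rightarrow> nat \<Rightarrow> 'a sgraph" where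
  "color_diff_graph G f g j =
     \<lparr>verts = \<Union>(color_diff_edges G f g j), edges = color_diff_edges G f g j\<rparr>"

definition graph_connected :: "'a sgraph \<Rightarrow> bool" where
  "graph_connected G \<longleftrightarrow> verts G \<noteq> {} \<and>
     (\<forall>u\<in>verts G. \<forall>v\<in>verts G. (\<lambda>x y. {x, y} \<in> edges G)\<^sup>*\<^sup>* u v)"

definition graph_component :: "'a sgraph \<Rightarrow> 'a sgraph \<Rightarrow> bool" where
  "graph_component C G \<longleftrightarrow> subgraph C G \<and> graph_connected C \<and>
     (\<forall>D. subgraph D G \<and> graph_connected D \<and> subgraph C D \<longrightarrow> D = C)"

definition is_path_of_length :: "'a sgraph \<Rightarrow> nat \<Rightarrow> bool" where
  "is_path_of_length P n \<longleftrightarrow>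
     (\<exists>p. distinct p \<and> length p = Suc n \<and> verts P = set p \<and>
          edges P = {{p ! i, p ! Suc i} | i. i < n})"

definition differ_by_at_most ::
  "'a sgraph \<Rightarrow> nat \<Rightarrow> nat \<Rightarrow> ('a set \<Rightarrow> nat) \<Rightarrow> ('a set \<Rightarrow> nat) \<Rightarrow> bool" where
  "differ_by_at_most G t n f g \<longleftrightarrow>
     card {j \<in> {1..t}. color_class G f j \<noteq> color_class G g j} \<le> n"

definition color_equivalent ::
  "'a sgraph \<Rightarrow> nat \<Rightarrow> nat \<Rightarrow> ('a set \<Rightarrow> nat) \<Rightarrow> ('a set \<Rightarrow> nat) \<Rightarrow> bool" where
  "color_equivalent G t n f h \<longleftrightarrow>
     (\<exists>k\<ge>1. \<exists>F :: nat \<Rightarrow> 'a set \<Rightarrow> nat. F 0 = f \<and> F k = h \<and>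
        (\<forall>i\<le>k. proper_edge_coloring G t (F i)) \<and>
        (\<forall>i\<in>{1..k}. differ_by_at_most G t n (F (i - 1)) (F i)))"

end

theory Submission
  imports Defs
begin

text \<open>
  An endpoint of the odd path is covered by exactly one of the two matchings \<open>M(f,t)\<close> and
  \<open>M(g,t)\<close>, say by \<open>M(f,t)\<close>; this is all that is used about the path. Starting there, we walk along
  the symmetric difference and give one edge of \<open>M(f,t)\<close> after the other the colour \<open>t\<close> in \<open>g\<close>.
  The intermediate objects are colourings of \<open>G\<close> with one edge removed whose two ends miss
  colours \<open>t\<close> and \<open>a\<close>. Such a partial colouring can be completed to a colouring of \<open>G\<close> by
  recolouring any \<open>q\<close> classes that include \<open>t\<close> and \<open>a\<close>, because their union together with the
  removed edge has maximum degree at most \<open>q\<close>. The completions destroy the colour class \<open>t\<close>, but they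
  are needed only to see that consecutive partial colourings have completions differing in at
  most \<open>q + 1\<close> classes; so the complete colouring at the end of the walk is equivalent to \<open>g\<close>.
\<close>

section \<open>Colourings of sets of edges\<close>

text \<open>The edge set is a parameter because the walk works with colourings that leave out one
  edge of \<open>G\<close>; values outside \<open>F\<close> are arbitrary.\<close>

definition proper_on :: "'a set set \<Rightarrow> nat \<Rightarrow> ('a set \<Rightarrow> nat) \<Rightarrow> bool" where
  "proper_on F t k \<longleftrightarrow> k ` F \<subseteq> {1..t} \<and>
     (\<forall>x\<in>F. \<forall>y\<in>F. adjacent_edges x y \<longrightarrow> k x \<noteq> k y)"

definition missing :: "'a set set \<Rightarrow> ('a set \<Rightarrow> nat) \<Rightarrow> 'a \<Rightarrow> nat \<Rightarrow> bool" where
  "missing F k p j \<longleftrightarrow> (\<forall>x\<in>F. p \<in> x \<longrightarrow> k x \<noteq> j)"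

text \<open>Comparing class by class allows different edge sets: removing an edge changes only the
  class of its colour.\<close>

definition agree_outside ::
  "nat set \<Rightarrow> 'a set set \<Rightarrow> ('a set \<Rightarrow> nat) \<Rightarrow> 'a set set \<Rightarrow> ('a set \<Rightarrow> nat) \<Rightarrow> bool" where
  "agree_outside W F k F' k' \<longleftrightarrow> (\<forall>j. j \<notin> W \<longrightarrow> {x \<in> F. k x = j} = {x \<in> F'. k' x = j})"

lemma agree_outside_sym: "agree_outside W F k F' k' \<Longrightarrow> agree_outside W F' k' F k"
  by (simp add: agree_outside_def)

lemma agree_outside_trans:
  "agree_outside W F k F' k' \<Longrightarrow> agree_outside W F' k' F'' k'' \<Longrightarrow> agree_outside W F k F'' k''"
  by (simp add: agree_outside_def)

lemma agree_outside_mono: "agree_outside S F k F' k' \<Longrightarrow> S \<subseteq> W \<Longrightarrow> agree_outside W F k F' k'"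
  by (auto simp: agree_outside_def)

lemma proper_onD:
  "proper_on F t k \<Longrightarrow> x \<in> F \<Longrightarrow> y \<in> F \<Longrightarrow> p \<in> x \<Longrightarrow> p \<in> y \<Longrightarrow> k x = k y \<Longrightarrow> x = y"
  unfolding proper_on_def adjacent_edges_def by blast

lemma proper_on_subset: "proper_on F t k \<Longrightarrow> F' \<subseteq> F \<Longrightarrow> proper_on F' t k"
  unfolding proper_on_def by blast

lemma proper_edge_coloring_imp_proper_on:
  "proper_edge_coloring G t c \<Longrightarrow> proper_on (edges G) t c"
  unfolding proper_edge_coloring_def edge_coloring_def proper_on_def by blast

lemma proper_on_imp_proper_edge_coloring:
  "proper_on (edges G) t c \<Longrightarrow> proper_edge_coloring G t (restrict c (edges G))"
  unfolding proper_edge_coloring_def edge_coloring_def proper_on_def by auto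

lemma proper_on_degree_le:
  assumes "proper_on F t k" "finite S" "\<And>x. x \<in> F \<Longrightarrow> p \<in> x \<Longrightarrow> x \<in> X \<Longrightarrow> k x \<in> S"
  shows "card {x \<in> F. p \<in> x \<and> x \<in> X} \<le> card S"
proof (rule card_inj_on_le[where f = k])
  show "inj_on k {x \<in> F. p \<in> x \<and> x \<in> X}"
    using proper_onD[OF assms(1)] by (intro inj_onI) blast
qed (use assms in auto)

lemma simple_graph_finite_edges: "simple_graph G \<Longrightarrow> finite (edges G)"
  unfolding simple_graph_def by (meson PowI finite_Pow_iff finite_subset subsetI)

section \<open>Recolouring \<open>q\<close> classes\<close>

text \<open>The subgraph on \<open>X\<close> has a colouring with \<open>{1..q}\<close>, which a
  bijection carries over to \<open>S\<close>.\<close>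

lemma class_A_recolor:
  assumes G: "G \<in> class_A q" and X: "X \<subseteq> edges G"
    and deg: "\<And>p. card {x \<in> X. p \<in> x} \<le> q" and S: "finite S" "card S = q"
  obtains k where "k ` X \<subseteq> S" "\<And>x y. x \<in> X \<Longrightarrow> y \<in> X \<Longrightarrow> adjacent_edges x y \<Longrightarrow> k x \<noteq> k y"
proof -
  let ?H = "\<lparr>verts = verts G, edges = X\<rparr>"
  have sG: "simple_graph G"
    using G by (simp add: class_A_def)
  have "subgraph ?H G"
    using sG X by (auto simp: subgraph_def simple_graph_def)
  moreover have "max_degree ?H \<le> q"
    using deg sG by (auto simp: max_degree_def vdegree_def simple_graph_def)
  ultimately obtain c where c: "proper_edge_coloring ?H q c"
    using G by (auto simp: class_A_def)
  obtain b where b: "bij_betw b {1..q} S"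
    using S finite_same_card_bij[of "{1..q}" S] by auto
  have cX: "c x \<in> {1..q}" if "x \<in> X" for x
    using c that unfolding proper_edge_coloring_def edge_coloring_def by auto
  show thesis
  proof (rule that[of "b \<circ> c"])
    show "(b \<circ> c) ` X \<subseteq> S"
      using cX b by (auto simp: bij_betw_def)
    show "(b \<circ> c) x \<noteq> (b \<circ> c) y" if "x \<in> X" "y \<in> X" "adjacent_edges x y" for x y
    proof -
      have "c x \<noteq> c y"
        using that c by (simp add: proper_edge_coloring_def)
      then show ?thesis
        using inj_onD[OF bij_betw_imp_inj_on[OF b] _ cX cX] that by (metis comp_apply)
    qed
  qed
qed

text \<open>Take \<open>e\<close> together with all classes in \<open>S\<close>. A vertex off
  \<open>e\<close> has at most one such edge per colour of \<open>S\<close>; at an end of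
  \<open>e\<close>, the missing colour makes room for \<open>e\<close>. So the maximum degree is at
  most \<open>q\<close>, and these edges can be recoloured from \<open>S\<close>.\<close>

lemma class_A_complete:
  assumes G: "G \<in> class_A q" and F: "F \<subseteq> edges G" "e \<in> F"
    and h: "proper_on (F - {e}) t h" and S: "S \<subseteq> {1..t}" "card S = q"
    and miss: "\<And>p. p \<in> e \<Longrightarrow> \<exists>a\<in>S. missing (F - {e}) h p a"
  obtains k where "proper_on F t k" "agree_outside S (F - {e}) h F k"
proof -
  let ?X = "insert e {x \<in> F - {e}. h x \<in> S}"
  have finS: "finite S"
    using S finite_subset by auto
  have finF: "finite F"
    using F G finite_subset simple_graph_finite_edges by (auto simp: class_A_def)
  have deg: "card {x \<in> ?X. p \<in> x} \<le> q" for p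
  proof (cases "p \<in> e")
    case False
    then have "{x \<in> ?X. p \<in> x} = {x \<in> F - {e}. p \<in> x \<and> x \<in> {x. h x \<in> S}}"
      by auto
    then show ?thesis
      using proper_on_degree_le[OF h finS, of p "{x. h x \<in> S}"] S by simp
  next
    case True
    then obtain a where a: "a \<in> S" "missing (F - {e}) h p a"
      using miss by blast
    let ?Y = "{x \<in> F - {e}. p \<in> x \<and> x \<in> {x. h x \<in> S}}"
    have "{x \<in> ?X. p \<in> x} = insert e ?Y"
      using True by auto
    moreover have "card ?Y \<le> card (S - {a})"
      by (rule proper_on_degree_le[OF h]) (use a finS in \<open>auto simp: missing_def\<close>)
    moreover have "card (S - {a}) = q - 1" "q > 0"
      using a finS S card_gt_0_iff by auto
    ultimately show ?thesis
      using finF by (simp add: card_insert_if)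
  qed
  obtain k0 where k0: "k0 ` ?X \<subseteq> S"
    "\<And>x y. x \<in> ?X \<Longrightarrow> y \<in> ?X \<Longrightarrow> adjacent_edges x y \<Longrightarrow> k0 x \<noteq> k0 y"
    using class_A_recolor[OF G _ deg finS S(2)] F by blast
  define k where "k x = (if x \<in> ?X then k0 x else h x)" for x
  have kX: "k x \<in> S" if "x \<in> ?X" for x
    using that k0(1) by (auto simp: k_def simp del: insert_iff)
  have kD: "x \<in> F - {e}" "h x \<notin> S" "k x = h x" if "x \<in> F" "x \<notin> ?X" for x
    using that by (auto simp: k_def)
  show thesis
  proof (rule that[of k])
    have "k x \<in> {1..t}" if "x \<in> F" for x
    proof (cases "x \<in> ?X")
      case True
      then show ?thesis
        using kX S(1) by blast
    next
      case False
      then show ?thesis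
        using kD[OF that] h unfolding proper_on_def by (metis image_subset_iff)
    qed
    \<comment> \<open>Recoloured edges have colours in \<open>S\<close> and all others keep colours
      outside \<open>S\<close>, so the two kinds cannot clash.\<close>
    moreover have "k x \<noteq> k y" if xy: "x \<in> F" "y \<in> F" "adjacent_edges x y" for x y
    proof (cases "x \<in> ?X"; cases "y \<in> ?X")
      assume "x \<in> ?X" "y \<in> ?X"
      then show ?thesis
        using k0(2) xy by (simp add: k_def del: insert_iff)
    next
      assume "x \<in> ?X" "y \<notin> ?X"
      then show ?thesis
        using kX[of x] kD(2,3)[OF xy(2)] by (metis (no_types, lifting))
    next
      assume "x \<notin> ?X" "y \<in> ?X"
      then show ?thesis
        using kX[of y] kD(2,3)[OF xy(1)] by (metis (no_types, lifting))
    next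
      assume "x \<notin> ?X" "y \<notin> ?X"
      then show ?thesis
        using kD[OF xy(1)] kD[OF xy(2)] xy(3) h unfolding proper_on_def by (simp del: insert_iff)
    qed
    ultimately show "proper_on F t k"
      unfolding proper_on_def by blast
    show "agree_outside S (F - {e}) h F k"
      unfolding agree_outside_def
    proof (intro allI impI set_eqI)
      fix j x assume "j \<notin> S"
      then show "x \<in> {x \<in> F - {e}. h x = j} \<longleftrightarrow> x \<in> {x \<in> F. k x = j}"
        using kX[of x] kD[of x] F(2) by (cases "x \<in> ?X") auto
    qed
  qed
qed

section \<open>Equivalence of colourings\<close>

lemma color_equivalent_refl:
  "proper_edge_coloring G t g \<Longrightarrow> color_equivalent G t n g g"
  unfolding color_equivalent_def differ_by_at_most_def
  by (rule exI[of _ 1]) (auto intro: exI[of _ "\<lambda>_. g"])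

lemma color_equivalent_step:
  fixes G :: "'a sgraph"
  assumes c: "proper_edge_coloring G t c" and eq: "color_equivalent G t n d g"
    and diff: "differ_by_at_most G t n c d"
  shows "color_equivalent G t n c g"
proof -
  obtain k where k: "k \<ge> 1" "\<exists>F :: nat \<Rightarrow> 'a set \<Rightarrow> nat. F 0 = d \<and> F k = g \<and>
      (\<forall>i\<le>k. proper_edge_coloring G t (F i)) \<and>
      (\<forall>i\<in>{1..k}. differ_by_at_most G t n (F (i - 1)) (F i))"
    using eq unfolding color_equivalent_def by blast
  then obtain F where F: "F 0 = d" "F k = g" "\<forall>i\<le>k. proper_edge_coloring G t (F i)"
    "\<forall>i\<in>{1..k}. differ_by_at_most G t n (F (i - 1)) (F i)"
    by (elim exE conjE) simp
  let ?F = "case_nat c F"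
  have "\<forall>i\<le>Suc k. proper_edge_coloring G t (?F i)"
    using F c by (auto split: nat.split)
  moreover have "\<forall>i\<in>{1..Suc k}. differ_by_at_most G t n (?F (i - 1)) (?F i)"
  proof
    fix i assume i: "i \<in> {1..Suc k}"
    show "differ_by_at_most G t n (?F (i - 1)) (?F i)"
    proof (cases "i = 1")
      case True
      then show ?thesis
        using diff F by simp
    next
      case False
      then obtain m where "i = Suc (Suc m)" "Suc m \<le> k"
        using i by (cases i; cases "i - 1") auto
      then show ?thesis
        using F(4)[rule_format, of "Suc m"] by simp
    qed
  qed
  ultimately show ?thesis
    unfolding color_equivalent_def using F by (intro exI[of _ "Suc k"] conjI exI[of _ ?F]) auto
qed

lemma agree_outside_differ:
  assumes "agree_outside W (edges G) c (edges G) d" "W \<subseteq> {1..t}" "card W = n"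
  shows "differ_by_at_most G t n c d"
proof -
  have "{j \<in> {1..t}. color_class G c j \<noteq> color_class G d j} \<subseteq> W"
    using assms(1) unfolding agree_outside_def color_class_def by auto
  then show ?thesis
    unfolding differ_by_at_most_def
    using card_mono[OF finite_subset[OF assms(2) finite_atLeastAtMost]] assms(3) by metis
qed

lemma edge_other_end:
  assumes "simple_graph G" "x \<in> edges G" "p \<in> x"
  obtains r where "x = {p, r}" "r \<noteq> p"
proof -
  have "card x = 2"
    using assms by (simp add: simple_graph_def)
  then show thesis
    using assms(3) that by (auto simp: card_2_iff)
qed

text \<open>Meant for \<open>M\<close> the class \<open>t\<close> of \<open>f\<close>, and
  \<open>T\<close>, \<open>T'\<close> the classes \<open>t\<close> of the other colouring before and
  after a round: the gain \<open>e\<close> lies in \<open>M\<close>, the only possible loss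
  \<open>e'\<close> does not.\<close>

lemma card_matching_exchange:
  assumes "finite M" "e \<in> M" "e' \<notin> M" "e \<notin> T"
    and "\<And>x. x \<noteq> e \<Longrightarrow> x \<noteq> e' \<Longrightarrow> x \<in> T \<Longrightarrow> x \<in> T'" "e \<in> T'"
  shows "card (M \<inter> T) < card (M \<inter> T')"
proof (rule psubset_card_mono)
  show "M \<inter> T \<subset> M \<inter> T'"
    using assms(2-) by (intro psubsetI) (auto, metis+)
qed (use assms in auto)

section \<open>The walk along the symmetric difference\<close>

text \<open>The invariant of the walk: only \<open>e\<close> is uncoloured, \<open>v\<close> misses
  \<open>t\<close> and \<open>w\<close> misses \<open>a\<close>. As \<open>k\<close> is partial, its
  relation to \<open>g\<close> is carried by the complete colouring \<open>d\<close>, which agrees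
  with \<open>k\<close> outside \<open>W\<close>. The gain is measured against class
  \<open>t\<close> of \<open>k\<close>, so rounds chain by transitivity.\<close>

lemma increase_common_class_from_partial:
  fixes G :: "'a sgraph"
  assumes q: "q \<ge> 2" and G: "G \<in> class_A q" and f: "proper_edge_coloring G t f"
    and k: "proper_on (edges G - {e}) t k"
    and e: "e \<in> edges G" "f e = t" "e = {v, w}" "v \<noteq> w"
    and miss_v: "missing (edges G - {e}) k v t" and miss_w: "missing (edges G - {e}) k w a"
    and W: "W \<subseteq> {1..t}" "card W = q + 1" "t \<in> W" "a \<in> W" "a \<noteq> t"
    and d: "proper_edge_coloring G t d" "color_equivalent G t (q + 1) d g"
    and agr: "agree_outside W (edges G) d (edges G - {e}) k"
  shows "\<exists>g'. proper_edge_coloring G t g' \<and> color_equivalent G t (q + 1) g' g \<and>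
     card (color_class G f t \<inter> {x \<in> edges G - {e}. k x = t})
       < card (color_class G f t \<inter> color_class G g' t)"
  using k e miss_v miss_w W d agr
\<comment> \<open>The measure is the number of edges with colour \<open>t\<close> under
  \<open>f\<close> but not under \<open>k\<close>; each round gives \<open>e\<close> colour
  \<open>t\<close>.\<close>
proof (induction "card (color_class G f t) - card (color_class G f t \<inter> {x \<in> edges G - {e}. k x = t})"
    arbitrary: k e v w a W d rule: less_induct)
  case (less k e v w a W d)
  note k = \<open>proper_on (edges G - {e}) t k\<close>
  note e = \<open>e \<in> edges G\<close> \<open>f e = t\<close> \<open>e = {v, w}\<close> \<open>v \<noteq> w\<close>
  note miss_v = \<open>missing (edges G - {e}) k v t\<close> and miss_w = \<open>missing (edges G - {e}) k w a\<close>
  note W = \<open>W \<subseteq> {1..t}\<close> \<open>card W = q + 1\<close> \<open>t \<in> W\<close> \<open>a \<in> W\<close> \<open>a \<noteq> t\<close>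
  note d = \<open>proper_edge_coloring G t d\<close> \<open>color_equivalent G t (q + 1) d g\<close>
  note agr = \<open>agree_outside W (edges G) d (edges G - {e}) k\<close>
  let ?E = "edges G"
  let ?Mf = "color_class G f t"
  let ?T = "{x \<in> ?E - {e}. k x = t}"
  have sG: "simple_graph G"
    using G by (simp add: class_A_def)
  have finE: "finite ?E"
    using simple_graph_finite_edges[OF sG] .
  have finM: "finite ?Mf"
    using finE by (simp add: color_class_def)
  have eM: "e \<in> ?Mf"
    using e by (simp add: color_class_def)
  have finW: "finite W"
    using W finite_subset by auto
  have t1: "t \<ge> 1"
    using W by auto
  have f': "proper_on ?E t f"
    using proper_edge_coloring_imp_proper_on[OF f] .
  define h where "h = k(e := t)"
  have hk: "h x = k x" if "x \<noteq> e" for x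
    using that by (simp add: h_def)
  have he: "h e = t"
    by (simp add: h_def)
  \<comment> \<open>Ends the walk with a complete \<open>c\<close> that has a larger common class
    and agrees outside \<open>V\<close> with some \<open>c0\<close> known to be equivalent to
    \<open>g\<close>.\<close>
  have finish: ?case
    if V: "V \<subseteq> {1..t}" "card V = q + 1" and c0: "proper_edge_coloring G t c0"
      "color_equivalent G t (q + 1) c0 g" "agree_outside V ?E c0 ?E c"
      and c: "proper_on ?E t c" and lt: "card (?Mf \<inter> ?T) < card (?Mf \<inter> {x \<in> ?E. c x = t})" for V c0 c
  proof -
    let ?c = "restrict c ?E"
    have p: "proper_edge_coloring G t ?c"
      using proper_on_imp_proper_edge_coloring[OF c] .
    have cl: "color_class G ?c j = {x \<in> ?E. c x = j}" for j
      by (auto simp: color_class_def)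
    have "agree_outside V ?E ?c ?E c0"
      using c0(3) cl unfolding agree_outside_def color_class_def by simp
    then have "color_equivalent G t (q + 1) ?c g"
      using agree_outside_differ[OF _ V] color_equivalent_step[OF p c0(2)] by blast
    then show ?thesis
      using p lt cl by auto
  qed
  show ?case
  proof (cases "missing (?E - {e}) k w t")
    case True
    \<comment> \<open>Both ends of \<open>e\<close> miss \<open>t\<close>, so giving
      \<open>e\<close> colour \<open>t\<close> completes \<open>k\<close>.\<close>
    have "proper_on ?E t h"
      unfolding proper_on_def
    proof (intro conjI ballI impI)
      show "h ` ?E \<subseteq> {1..t}"
        using k t1 by (auto simp: h_def proper_on_def)
      show "h x \<noteq> h y" if "x \<in> ?E" "y \<in> ?E" "adjacent_edges x y" for x y
      proof -
        have "k z \<noteq> t" if "z \<in> ?E" "z \<noteq> e" "z \<inter> e \<noteq> {}" for z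
          using that True miss_v e(3) unfolding missing_def by blast
        then show ?thesis
          using that k unfolding h_def proper_on_def adjacent_edges_def
          by (auto simp: Int_commute)
      qed
    qed
    moreover have "agree_outside W ?E d ?E h"
    proof (rule agree_outside_trans[OF agr])
      show "agree_outside W (?E - {e}) k ?E h"
        using W(3) by (auto simp: agree_outside_def h_def)
    qed
    moreover have "card (?Mf \<inter> ?T) < card (?Mf \<inter> {x \<in> ?E. h x = t})"
      using eM finM by (intro psubset_card_mono psubsetI) (auto simp: h_def color_class_def)
    ultimately show ?thesis
      using finish[OF W(1,2) d] by blast
  next
    case False
    \<comment> \<open>\<open>e'\<close> blocks colour \<open>t\<close> at \<open>w\<close>. It
      becomes the uncoloured edge while \<open>e\<close> takes \<open>t\<close>; then
      \<open>z\<close> misses \<open>t\<close> and \<open>w\<close> still misses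
      \<open>a\<close>.\<close>
    then obtain e' where e': "e' \<in> ?E" "e' \<noteq> e" "w \<in> e'" "k e' = t"
      unfolding missing_def by blast
    obtain z where z: "e' = {w, z}" "z \<noteq> w"
      using edge_other_end[OF sG e'(1,3)] .
    have zv: "z \<noteq> v" and zne: "z \<notin> e"
      using z e'(2) e(3) by auto
    \<comment> \<open>Class \<open>t\<close> of \<open>f\<close> already covers \<open>w\<close> by
      \<open>e\<close>, so uncolouring \<open>e'\<close> loses no common edge.\<close>
    have e'M: "f e' \<noteq> t"
      using proper_onD[OF f' e'(1) e(1) e'(3)] e e'(2) by auto
    have only_t: "x = e'" if "x \<in> ?E" "x \<noteq> e" "k x = t" "w \<in> x \<or> z \<in> x" for x
      using proper_onD[OF k, of x e'] that e' z by auto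
    have hp: "proper_on (?E - {e'}) t h"
      unfolding proper_on_def
    proof (intro conjI ballI impI)
      show "h ` (?E - {e'}) \<subseteq> {1..t}"
        using k t1 by (auto simp: h_def proper_on_def)
      show "h x \<noteq> h y" if "x \<in> ?E - {e'}" "y \<in> ?E - {e'}" "adjacent_edges x y" for x y
      proof -
        have "k z \<noteq> t" if "z \<in> ?E - {e'}" "z \<noteq> e" "z \<inter> e \<noteq> {}" for z
          using that only_t miss_v e(3) unfolding missing_def by blast
        then show ?thesis
          using that k unfolding h_def proper_on_def adjacent_edges_def
          by (auto simp: Int_commute)
      qed
    qed
    have h_w: "missing (?E - {e'}) h w a"
      using miss_w W(5) unfolding missing_def by (auto simp: h_def)
    have h_z: "missing (?E - {e'}) h z t"
      using only_t zne unfolding missing_def by (auto simp: h_def)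
    have swap: "agree_outside {t} (?E - {e}) k (?E - {e'}) h"
      using e'(4) by (auto simp: agree_outside_def h_def)
    \<comment> \<open>Dropping a colour \<open>s\<close> other than \<open>a\<close> and
      \<open>t\<close> leaves the \<open>q\<close> colours needed for a completion, and room for one
      new colour within the \<open>q + 1\<close> allowed in a step.\<close>
    have "card {a, t} < card W"
      using W q by simp
    then obtain s where s: "s \<in> W" "s \<noteq> a" "s \<noteq> t"
      by (metis card_mono finite.emptyI finite.insertI insertCI leD subsetI)
    define S where "S = W - {s}"
    have S: "S \<subseteq> {1..t}" "card S = q" "a \<in> S" "t \<in> S" "finite S"
      using s W finW by (auto simp: S_def)
    \<comment> \<open>The completion \<open>c\<close> is the link to the next partial colouring: that one is completed inside
      \<open>V\<close>, and both \<open>W\<close> and \<open>V\<close> contain \<open>S\<close>.\<close>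
    obtain c where c: "proper_edge_coloring G t c" "color_equivalent G t (q + 1) c g"
      "agree_outside S (?E - {e}) k ?E c"
    proof -
      have "\<exists>a\<in>S. missing (?E - {e}) k p a" if "p \<in> e" for p
        using that e(3) S miss_v miss_w by blast
      then obtain c0 where c0: "proper_on ?E t c0" "agree_outside S (?E - {e}) k ?E c0"
        using class_A_complete[OF G subset_refl e(1) k S(1,2)] by metis
      let ?c = "restrict c0 ?E"
      have p: "proper_edge_coloring G t ?c"
        using proper_on_imp_proper_edge_coloring[OF c0(1)] .
      have ag: "agree_outside S (?E - {e}) k ?E ?c"
        using c0(2) by (auto simp: agree_outside_def)
      then have "agree_outside W ?E d ?E ?c"
        using agree_outside_trans[OF agr] agree_outside_mono[OF ag] S_def by blast
      then have "color_equivalent G t (q + 1) ?c g"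
        using agree_outside_differ[OF agree_outside_sym W(1,2)] color_equivalent_step[OF p d(2)] by blast
      with p ag show thesis
        using that by blast
    qed
    have to_h: "agree_outside V ?E c (?E - {e'}) h" if "S \<subseteq> V" for V
      by (rule agree_outside_trans[OF agree_outside_sym[OF agree_outside_mono[OF c(3) that]]
            agree_outside_mono[OF swap]])
        (use that S(4) in blast)
    \<comment> \<open>If \<open>b\<close> is in \<open>W\<close>, including the case that it is in
      \<open>S\<close>, then \<open>W\<close> itself serves; otherwise \<open>b\<close> takes the
      place of \<open>s\<close>.\<close>
    have exV: "\<exists>V. V \<subseteq> {1..t} \<and> card V = q + 1 \<and> S \<subseteq> V \<and> b \<in> V" if "b \<in> {1..t}" for b
    proof (cases "b \<in> W")
      case True
      then show ?thesis
        using W S_def by (intro exI[of _ W]) auto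
    next
      case False
      then show ?thesis
        using S that S_def by (intro exI[of _ "insert b S"]) auto
    qed
    \<comment> \<open>Now \<open>e'\<close> is coloured from the \<open>q\<close> colours of
      \<open>V - {t}\<close>, so class \<open>t\<close> of \<open>h\<close> survives. The ends
      \<open>w\<close> and \<open>z\<close> miss \<open>a\<close> and \<open>b\<close>, both in this
      set.\<close>
    have recolor: "\<exists>k'. proper_on F t k' \<and> agree_outside (V - {t}) (F - {e'}) h F k'"
      if V: "V \<subseteq> {1..t}" "card V = q + 1" "S \<subseteq> V" and b: "b \<in> V" "b \<noteq> t"
        and F: "F \<subseteq> ?E" "e' \<in> F" and hz: "missing (F - {e'}) h z b" for V b F
    proof (rule class_A_complete[OF G F, of t h "V - {t}"])
      show "proper_on (F - {e'}) t h"
        using proper_on_subset[OF hp] F by blast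
      show "V - {t} \<subseteq> {1..t}" "card (V - {t}) = q"
        using V S(4) finite_subset[OF V(1)] by auto
      have "missing (F - {e'}) h w a"
        using h_w F unfolding missing_def by blast
      then show "\<exists>a\<in>V - {t}. missing (F - {e'}) h p a" if "p \<in> e'" for p
        using that z(1) hz b V(3) S(3) W(5) by blast
    qed blast
    show ?thesis
    proof (cases "missing ?E f z t")
      case True
      let ?Z = "{x \<in> ?E. z \<in> x}"
      have "card {x \<in> ?E. z \<in> x \<and> x \<in> UNIV} \<le> card {1..<t}"
        using True f' by (intro proper_on_degree_le[OF f']) (force simp: missing_def proper_on_def)+
      then have "card ?Z \<le> t - 1"
        by simp
      moreover have "card (?Z - {e'}) < card ?Z"
        using e' z finE by (intro psubset_card_mono) auto
      ultimately have "card (h ` (?Z - {e'})) < card {1..<t}"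
        using card_image_le[of "?Z - {e'}" h] finE by simp
      then have "\<not> {1..<t} \<subseteq> h ` (?Z - {e'})"
        using card_mono[of "h ` (?Z - {e'})" "{1..<t}"] finE by auto
      then obtain b where b: "b \<in> {1..<t}" "b \<notin> h ` (?Z - {e'})"
        by blast
      obtain V where V: "V \<subseteq> {1..t}" "card V = q + 1" "S \<subseteq> V" "b \<in> V"
        using exV[of b] b by auto
      have "missing (?E - {e'}) h z b"
        using b unfolding missing_def by auto
      then obtain k' where k': "proper_on ?E t k'" "agree_outside (V - {t}) (?E - {e'}) h ?E k'"
        using recolor[OF V, of ?E] b e' by auto
      have "agree_outside V ?E c ?E k'"
        by (rule agree_outside_trans[OF to_h[OF V(3)] agree_outside_mono[OF k'(2) Diff_subset]])
      moreover have "card (?Mf \<inter> ?T) < card (?Mf \<inter> {x \<in> ?E. k' x = t})"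
      proof (rule card_matching_exchange[OF finM eM])
        have T': "{x \<in> ?E. k' x = t} = {x \<in> ?E - {e'}. h x = t}"
          using k'(2) unfolding agree_outside_def by auto
        show "e' \<notin> ?Mf" "e \<notin> ?T"
          using e'M by (auto simp: color_class_def)
        show "e \<in> {x \<in> ?E. k' x = t}"
          unfolding T' using e e' he by auto
        show "x \<in> {x \<in> ?E. k' x = t}" if "x \<noteq> e" "x \<noteq> e'" "x \<in> ?T" for x
          unfolding T' using that hk by auto
      qed
      ultimately show ?thesis
        using finish[OF V(1,2) c(1,2)] k'(1) by blast
    next
      case False
      \<comment> \<open>The walk continues along \<open>e''\<close>. Removing it frees its colour
        \<open>b\<close> at \<open>z\<close>, as \<open>recolor\<close> requires for colouring
        \<open>e'\<close>.\<close>
      then obtain e'' where e'': "e'' \<in> ?E" "z \<in> e''" "f e'' = t"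
        unfolding missing_def by blast
      obtain y where y: "e'' = {z, y}" "y \<noteq> z"
        using edge_other_end[OF sG e''(1,2)] .
      have ne: "e'' \<noteq> e" "e'' \<noteq> e'"
        using zne e'' e'M by auto
      then have yne: "y \<notin> e'"
        using y z by auto
      define b where "b = k e''"
      have b: "b \<in> {1..t}" "b \<noteq> t" "h e'' = b"
        using k e'' ne only_t[of e''] unfolding b_def h_def proper_on_def by auto
      obtain V where V: "V \<subseteq> {1..t}" "card V = q + 1" "S \<subseteq> V" "b \<in> V"
        using exV[OF b(1)] by auto
      let ?F = "?E - {e''}"
      have hb: "missing (?F - {e'}) h p b" if "p \<in> e''" for p
        unfolding missing_def
      proof (intro ballI impI notI)
        fix x assume "x \<in> ?F - {e'}" "p \<in> x" "h x = b"
        then show False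
          using proper_onD[OF hp, of x e'' p] that e''(1) ne(2) b(3) by simp
      qed
      have "e' \<in> ?F"
        using e'(1) ne(2) by simp
      then obtain k' where k': "proper_on ?F t k'" "agree_outside (V - {t}) (?F - {e'}) h ?F k'"
        using recolor[OF V b(2) Diff_subset _ hb[OF e''(2)]] by blast
      have T': "{x \<in> ?F. k' x = t} = {x \<in> ?E - {e'}. h x = t}"
        using k'(2) b unfolding agree_outside_def by auto
      have "agree_outside V (?E - {e'}) h (?F - {e'}) h"
        using b(3) V(4) by (auto simp: agree_outside_def)
      note agr' = agree_outside_trans[OF agree_outside_trans[OF to_h[OF V(3)] this]
          agree_outside_mono[OF k'(2) Diff_subset]]
      have lt: "card (?Mf \<inter> ?T) < card (?Mf \<inter> {x \<in> ?F. k' x = t})"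
      proof (rule card_matching_exchange[OF finM eM])
        show "e' \<notin> ?Mf" "e \<notin> ?T"
          using e'M by (auto simp: color_class_def)
        show "e \<in> {x \<in> ?F. k' x = t}"
          unfolding T' using e e' he by auto
        show "x \<in> {x \<in> ?F. k' x = t}" if "x \<noteq> e" "x \<noteq> e'" "x \<in> ?T" for x
          unfolding T' using that hk by auto
      qed
      have le: "card (?Mf \<inter> {x \<in> ?F. k' x = t}) \<le> card ?Mf"
        using finM by (intro card_mono) auto
      have miss_z: "missing ?F k' z t"
        using T' h_z unfolding missing_def by blast
      \<comment> \<open>Without \<open>e''\<close>, \<open>y\<close> misses \<open>b\<close> under
        \<open>h\<close>, so at most \<open>q - 1\<close> edges at \<open>y\<close> have colours in
        \<open>V - {t}\<close>. As \<open>e'\<close> avoids \<open>y\<close>, recolouring adds none,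
        and \<open>k'\<close> leaves one of these \<open>q\<close> colours free at
        \<open>y\<close>.\<close>
      obtain a' where a': "a' \<in> V - {t}" "missing ?F k' y a'"
      proof -
        let ?Y = "{x \<in> ?F - {e'}. y \<in> x \<and> x \<in> {x. h x \<in> V - {t}}}"
        have finV: "finite (V - {t})"
          using V finite_subset by auto
        have sub: "{x \<in> ?F. y \<in> x \<and> k' x \<in> V - {t}} \<subseteq> ?Y"
        proof
          fix x assume x: "x \<in> {x \<in> ?F. y \<in> x \<and> k' x \<in> V - {t}}"
          then have "x \<in> ?F - {e'}"
            using yne by auto
          moreover have "h x \<in> V - {t}"
          proof (rule ccontr)
            assume n: "h x \<notin> V - {t}"
            then have "x \<in> {x \<in> ?F. k' x = h x}"
              using k'(2) \<open>x \<in> ?F - {e'}\<close> unfolding agree_outside_def by blast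
            with n x show False
              by simp
          qed
          ultimately show "x \<in> ?Y"
            using x by auto
        qed
        have "card ?Y \<le> card (V - {t} - {b})"
          by (rule proper_on_degree_le[OF proper_on_subset[OF hp]])
            (use hb[of y] y finV in \<open>auto simp: missing_def\<close>)
        also have "\<dots> < card (V - {t})"
          using finV V(4) b(2) by (intro psubset_card_mono) auto
        finally have "card (k' ` {x \<in> ?F. y \<in> x \<and> k' x \<in> V - {t}}) < card (V - {t})"
          using card_mono[OF _ sub] card_image_le[of "{x \<in> ?F. y \<in> x \<and> k' x \<in> V - {t}}" k'] finE
          by fastforce
        then have "\<not> V - {t} \<subseteq> k' ` {x \<in> ?F. y \<in> x \<and> k' x \<in> V - {t}}"
          using card_mono[of "k' ` {x \<in> ?F. y \<in> x \<and> k' x \<in> V - {t}}" "V - {t}"] finE by auto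
        then show thesis
          using that unfolding missing_def by blast
      qed
      \<comment> \<open>The next round has \<open>e''\<close>, \<open>z\<close>, \<open>y\<close>,
        \<open>a'\<close>, \<open>V\<close>, \<open>c\<close> in the roles of \<open>e\<close>,
        \<open>v\<close>, \<open>w\<close>, \<open>a\<close>, \<open>W\<close>,
        \<open>d\<close>.\<close>
      obtain g' where "proper_edge_coloring G t g'" "color_equivalent G t (q + 1) g' g"
        "card (?Mf \<inter> {x \<in> ?F. k' x = t}) < card (?Mf \<inter> color_class G g' t)"
      proof (atomize_elim, rule less.hyps[OF _ k'(1) e''(1,3) y(1) y(2)[symmetric] miss_z a'(2) V(1,2) _ _ _ c(1,2) agr'])
        show "card ?Mf - card (?Mf \<inter> {x \<in> ?F. k' x = t}) < card ?Mf - card (?Mf \<inter> ?T)"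
          using lt le by linarith
        show "t \<in> V" "a' \<in> V" "a' \<noteq> t"
          using V(3) S(4) a'(1) by auto
      qed
      with lt show ?thesis
        by (meson less_trans)
    qed
  qed
qed

text \<open>The walk starts by uncolouring \<open>e\<close> in \<open>g\<close>. This leaves class
  \<open>t\<close> unchanged because \<open>g e \<noteq> t\<close>, and makes the other end miss
  \<open>g e\<close>. The complete colouring of the invariant is \<open>g\<close> itself.\<close>

lemma increase_common_class:
  fixes G :: "'a sgraph"
  assumes q: "q \<ge> 2" "q + 1 \<le> t" and G: "G \<in> class_A q"
    and f: "proper_edge_coloring G t f" and g: "proper_edge_coloring G t g"
    and e: "e \<in> edges G" "f e = t" "v \<in> e" and miss_v: "missing (edges G) g v t"
  shows "\<exists>g'. proper_edge_coloring G t g' \<and> color_equivalent G t (q + 1) g' g \<and>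
     card (color_class G f t \<inter> color_class G g t) < card (color_class G f t \<inter> color_class G g' t)"
proof -
  have sG: "simple_graph G"
    using G by (simp add: class_A_def)
  obtain w where w: "e = {v, w}" "w \<noteq> v"
    using edge_other_end[OF sG e(1,3)] .
  have g': "proper_on (edges G) t g"
    using proper_edge_coloring_imp_proper_on[OF g] .
  have ge: "g e \<in> {1..t}" "g e \<noteq> t"
    using g' e miss_v unfolding proper_on_def missing_def by auto
  have "\<exists>W. {g e, t} \<subseteq> W \<and> W \<subseteq> {1..t} \<and> card W = q + 1"
    using ge q by (intro exists_subset_between) auto
  then obtain W where W: "{g e, t} \<subseteq> W" "W \<subseteq> {1..t}" "card W = q + 1"
    by blast
  have "{x \<in> edges G - {e}. g x = t} = color_class G g t"
    using ge by (auto simp: color_class_def)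
  moreover have "missing (edges G - {e}) g v t"
    using miss_v by (simp add: missing_def)
  moreover have "missing (edges G - {e}) g w (g e)"
    using proper_onD[OF g', of _ e w] e w unfolding missing_def by auto
  moreover have "agree_outside W (edges G) g (edges G - {e}) g"
    using W(1) by (auto simp: agree_outside_def)
  moreover have "t \<in> W" "g e \<in> W"
    using W(1) by auto
  ultimately show ?thesis
    using increase_common_class_from_partial[OF q(1) G f proper_on_subset[OF g' Diff_subset] e(1,2) w(1) w(2)[symmetric] _ _ W(2,3)
        _ _ ge(2) g color_equivalent_refl[OF g]]
    by metis
qed

section \<open>Components and the end of the odd path\<close>

text \<open>Adding \<open>x\<close> and its other end to \<open>C\<close> gives a connected subgraph
  again, so maximality makes it equal to \<open>C\<close>.\<close>

lemma graph_component_edge_closed: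
  assumes C: "graph_component C G" and G: "simple_graph G"
    and x: "x \<in> edges G" "p \<in> x" "p \<in> verts C"
  shows "x \<in> edges C"
proof -
  obtain r where r: "x = {p, r}" "r \<noteq> p"
    using edge_other_end[OF G x(1,2)] .
  let ?D = "\<lparr>verts = insert r (verts C), edges = insert x (edges C)\<rparr>"
  let ?R = "\<lambda>u v. {u, v} \<in> edges ?D"
  have sub: "subgraph C G" and con: "graph_connected C"
    using C by (auto simp: graph_component_def)
  have "subgraph ?D G" "subgraph C ?D"
    using sub x r G by (auto simp: subgraph_def simple_graph_def)
  moreover have "graph_connected ?D"
  proof -
    have old: "?R\<^sup>*\<^sup>* u v" if "u \<in> verts C" "v \<in> verts C" for u v
    proof -
      have "(\<lambda>u v. {u, v} \<in> edges C)\<^sup>*\<^sup>* u v"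
        using con that by (auto simp: graph_connected_def)
      then show ?thesis
        by (rule rtranclp_mono[THEN predicate2D, rotated]) auto
    qed
    have pr: "?R\<^sup>*\<^sup>* p r" "?R\<^sup>*\<^sup>* r p"
      using r by (auto intro!: r_into_rtranclp simp: insert_commute)
    have "?R\<^sup>*\<^sup>* u p" "?R\<^sup>*\<^sup>* p u" if "u \<in> verts ?D" for u
      using that old[of u p] old[of p u] pr x(3) by auto
    then show ?thesis
      unfolding graph_connected_def by (auto intro: rtranclp_trans simp del: insert_iff)
  qed
  ultimately have "?D = C"
    using C by (auto simp: graph_component_def)
  then show ?thesis
    by (metis insertI1 sgraph.select_convs(2))
qed

text \<open>An end of the path meets just one edge of the symmetric difference. An edge of the other
  class \<open>j\<close> at that vertex would be a second one, or lie in both classes and clash with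
  the first.\<close>

lemma odd_path_end_covered_once:
  assumes G: "simple_graph G" and f: "proper_edge_coloring G t f" and g: "proper_edge_coloring G t g"
    and P: "graph_component P (color_diff_graph G f g j)" "is_path_of_length P n" "odd n"
  obtains v e where "e \<in> edges G" "v \<in> e" "f e = j" "missing (edges G) g v j"
  | v e where "e \<in> edges G" "v \<in> e" "g e = j" "missing (edges G) f v j"
proof -
  obtain p where p: "distinct p" "length p = Suc n" "verts P = set p"
    "edges P = {{p ! i, p ! Suc i} | i. i < n}"
    using P(2) unfolding is_path_of_length_def by blast
  let ?D = "color_diff_graph G f g j"
  have D: "edges ?D = {x \<in> edges G. f x = j \<longleftrightarrow> g x \<noteq> j}"
    by (auto simp: color_diff_graph_def color_diff_edges_def color_class_def)
  have sD: "simple_graph ?D"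
  proof -
    have "verts ?D \<subseteq> verts G"
      using G by (auto simp: color_diff_graph_def color_diff_edges_def color_class_def simple_graph_def)
    then have "finite (verts ?D)"
      using G finite_subset by (auto simp: simple_graph_def)
    moreover have "x \<subseteq> verts ?D" if "x \<in> edges ?D" for x
      using that by (auto simp: color_diff_graph_def)
    moreover have "card x = 2" if "x \<in> edges ?D" for x
      using that G D by (auto simp: simple_graph_def)
    ultimately show ?thesis
      by (simp add: simple_graph_def)
  qed
  let ?v = "p ! 0"
  let ?e = "{p ! 0, p ! Suc 0}"
  have n: "n > 0"
    using P(3) by (cases n) auto
  have "?e \<in> edges P"
    using p(4) n by auto
  then have e: "?e \<in> edges ?D"
    using P(1) unfolding graph_component_def subgraph_def by blast
  have only: "x = ?e" if "x \<in> edges ?D" "?v \<in> x" for x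
  proof -
    have "x \<in> edges P"
      using graph_component_edge_closed[OF P(1) sD that] p n by auto
    then obtain i where i: "i < n" "x = {p ! i, p ! Suc i}"
      using p(4) by blast
    then have "i = 0"
      using that(2) p(1,2) n by (auto simp: nth_eq_iff_index_eq)
    then show ?thesis
      using i by simp
  qed
  \<comment> \<open>\<open>k\<close> stands for the colouring that gives \<open>?e\<close> colour
    \<open>j\<close>, and \<open>k'\<close> for the other one, so that both cases are
    served.\<close>
  have miss: "missing (edges G) k' ?v j"
    if k: "proper_on (edges G) t k" "k ?e = j" "k' ?e \<noteq> j"
      and kk: "\<And>x. x \<in> edges G \<Longrightarrow> k x \<noteq> j \<Longrightarrow> k' x = j \<Longrightarrow> x \<in> edges ?D" for k k'
    unfolding missing_def
  proof (intro ballI impI notI)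
    fix x assume x: "x \<in> edges G" "?v \<in> x" "k' x = j"
    have "x \<noteq> ?e"
      using x k by auto
    then have "k x \<noteq> j"
      using proper_onD[OF k(1), of x ?e ?v] x k(2) e D by auto
    then show False
      using kk x only \<open>x \<noteq> ?e\<close> by blast
  qed
  show thesis
  proof (cases "f ?e = j")
    case True
    then show thesis
      using that(1)[of ?e ?v] miss[OF proper_edge_coloring_imp_proper_on[OF f], of g] e D by auto
  next
    case False
    then show thesis
      using that(2)[of ?e ?v] miss[OF proper_edge_coloring_imp_proper_on[OF g], of f] e D by auto
  qed
qed

theorem lemma3p2:
  fixes G :: "'a sgraph" and q t :: nat and f g :: "'a set \<Rightarrow> nat"
  assumes "q \<ge> 3"
    and "G \<in> class_A q"
    and "max_degree G = t"
    and "t \<ge> q + 2"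
    and "proper_edge_coloring G t f"
    and "proper_edge_coloring G t g"
    and "f \<noteq> g"
    and "\<exists>P n. graph_component P (color_diff_graph G f g t) \<and> is_path_of_length P n \<and> odd n"
  shows "\<exists>f' g'. proper_edge_coloring G t f' \<and> proper_edge_coloring G t g' \<and>
           color_equivalent G t (q + 1) f' f \<and> color_equivalent G t (q + 1) g' g \<and>
           card (color_class G f' t \<inter> color_class G g' t)
             > card (color_class G f t \<inter> color_class G g t)"
proof -
  have q: "q \<ge> 2" "q + 1 \<le> t"
    using assms(1,4) by auto
  have sG: "simple_graph G"
    using assms(2) by (simp add: class_A_def)
  obtain P n where "graph_component P (color_diff_graph G f g t)" "is_path_of_length P n" "odd n"
    using assms(8) by blast
  then show ?thesis
  \<comment> \<open>Only one colouring changes: \<open>g\<close> if class \<open>t\<close> of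
    \<open>f\<close> covers the end, otherwise \<open>f\<close>, with the roles exchanged.\<close>
  proof (rule odd_path_end_covered_once[OF sG assms(5,6)])
    fix v e assume "e \<in> edges G" "v \<in> e" "f e = t" "missing (edges G) g v t"
    then show ?thesis
      using increase_common_class[OF q assms(2,5,6), of e v] color_equivalent_refl[OF assms(5)] assms(5)
      by blast
  next
    fix v e assume "e \<in> edges G" "v \<in> e" "g e = t" "missing (edges G) f v t"
    then show ?thesis
      using increase_common_class[OF q assms(2,6,5), of e v] color_equivalent_refl[OF assms(6)] assms(6)
      by (metis Int_commute)
  qed
qed

end
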